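(* Let $R$ be a semiring, $X$ a topological space, and $\mathcal{F}$ a sheaf of $R$-semimodules on $X$. Let $\mathcal{U}$ be an open covering of $X$. Then $$\check{H}^0(\mathcal{U},\mathcal{F})=\mathcal{F}(X).$$
   Context: Semirings are commutative with $0\neq 1$ and absorbing $0$; semimodules over a semiring are commutative monoids with a scalar multiplication satisfying the usual axioms. Čech cohomology of sheaves of semimodules. Let $\mathcal U=\{U_i\}_{i\in I}$ be an open covering of $X$ with $I$ totally ordered. Put $U_{i_0\cdots i_n}=U_{i_0}\cap\dots\cap U_{i_n}$, $C^n=C^n(\mathcal U,\mathcal F)=\prod_{i_0<\dots<i_n}\mathcal F(U_{i_0\cdots i_n})$ for $n\ge0$, $C^n=0$ for $n<0$, and $$(d_n^{+}x)_{i_0\cdots i_{n+1}}=\sum_{k\text{ even}} x_{i_0\cdots\hat{i_k}\cdots i_{n+1}}|_{U_{i_0\cdots i_{n+1}}},\qquad (d_n^{-}x)_{i_0\cdots i_{n+1}}=\sum_{k\text{ odd}} x_{i_0\cdots\hat{i_k}\cdots i_{n+1}}|_{U_{i_0\cdots i_{n+1}}},$$ where $0\le k\le n+1$. Put $Z^n=\{x\in C^n: d_n^+(x)=d_n^-(x)\}$ and $\check H^n(\mathcal U,\mathcal F)=Z^n/\rho^n$, where $\rho^n$ is the congruence: $x\,\rho^n\,y$ iff $x+d_{n-1}^+(u)+d_{n-1}^-(v)=y+d_{n-1}^+(v)+d_{n-1}^-(u)$ for some $u,v\in C^{n-1}$. The equality in the claim means that the map $\mathcal F(X)\to \check H^0(\mathcal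 U,\mathcal F)$ induced by restriction is an isomorphism of $R$-semimodules. *)

theory Defs
  imports "HOL-Analysis.Abstract_Topology" "HOL-Algebra.Module"
begin

section \<open>Semirings and semimodules\<close>

locale commutative_semiring = Ring.semiring R + Group.comm_monoid R for R (structure) +
  assumes zero_not_one: "\<zero> \<noteq> \<one>"

text \<open>As for modules in HOL-Algebra, the fields \<open>mult\<close> and \<open>one\<close> of the record \<open>M\<close>
  carry no meaning.\<close>

locale semimodule = R?: commutative_semiring R + M?: abelian_monoid M
    for R :: "('r, 'x) ring_scheme" (structure) and M :: "('r, 'm, 'y) module_scheme" (structure) +
  assumes smult_closed: "\<lbrakk>a \<in> carrier R; x \<in> carrier M\<rbrakk> \<Longrightarrow> a \<odot>\<^bsub>M\<^esub> x \<in> carrier M"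
    and smult_add_left: "\<lbrakk>a \<in> carrier R; b \<in> carrier R; x \<in> carrier M\<rbrakk>
      \<Longrightarrow> (a \<oplus>\<^bsub>R\<^esub> b) \<odot>\<^bsub>M\<^esub> x = a \<odot>\<^bsub>M\<^esub> x \<oplus>\<^bsub>M\<^esub> b \<odot>\<^bsub>M\<^esub> x"
    and smult_add_right: "\<lbrakk>a \<in> carrier R; x \<in> carrier M; y \<in> carrier M\<rbrakk>
      \<Longrightarrow> a \<odot>\<^bsub>M\<^esub> (x \<oplus>\<^bsub>M\<^esub> y) = a \<odot>\<^bsub>M\<^esub> x \<oplus>\<^bsub>M\<^esub> a \<odot>\<^bsub>M\<^esub> y"
    and smult_mult: "\<lbrakk>a \<in> carrier R; b \<in> carrier R; x \<in> carrier M\<rbrakk>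
      \<Longrightarrow> (a \<otimes>\<^bsub>R\<^esub> b) \<odot>\<^bsub>M\<^esub> x = a \<odot>\<^bsub>M\<^esub> (b \<odot>\<^bsub>M\<^esub> x)"
    and smult_one: "x \<in> carrier M \<Longrightarrow> \<one>\<^bsub>R\<^esub> \<odot>\<^bsub>M\<^esub> x = x"
    and smult_zero_left: "x \<in> carrier M \<Longrightarrow> \<zero>\<^bsub>R\<^esub> \<odot>\<^bsub>M\<^esub> x = \<zero>\<^bsub>M\<^esub>"
    and smult_zero_right: "a \<in> carrier R \<Longrightarrow> a \<odot>\<^bsub>M\<^esub> \<zero>\<^bsub>M\<^esub> = \<zero>\<^bsub>M\<^esub>"

locale semimodule_hom = dom: semimodule R M + cod: semimodule R N
    for R :: "('r, 'x) ring_scheme" and M :: "('r, 'm, 'y) module_scheme"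
      and N :: "('r, 'n, 'z) module_scheme" +
  fixes f :: "'m \<Rightarrow> 'n"
  assumes hom_closed: "x \<in> carrier M \<Longrightarrow> f x \<in> carrier N"
    and hom_zero: "f \<zero>\<^bsub>M\<^esub> = \<zero>\<^bsub>N\<^esub>"
    and hom_add: "\<lbrakk>x \<in> carrier M; y \<in> carrier M\<rbrakk> \<Longrightarrow> f (x \<oplus>\<^bsub>M\<^esub> y) = f x \<oplus>\<^bsub>N\<^esub> f y"
    and hom_smult: "\<lbrakk>a \<in> carrier R; x \<in> carrier M\<rbrakk> \<Longrightarrow> f (a \<odot>\<^bsub>M\<^esub> x) = a \<odot>\<^bsub>N\<^esub> f x"

locale semimodule_iso = semimodule_hom +
  assumes bij: "bij_betw f (carrier M) (carrier N)"

definition semimodule_product ::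
    "'j set \<Rightarrow> ('j \<Rightarrow> ('r, 'm) module) \<Rightarrow> ('r, 'j \<Rightarrow> 'm) module" where
  "semimodule_product J M =
    \<lparr>carrier = (\<Pi>\<^sub>E j\<in>J. carrier (M j)), mult = undefined, one = undefined,
     zero = (\<lambda>j\<in>J. \<zero>\<^bsub>M j\<^esub>), add = (\<lambda>x y. \<lambda>j\<in>J. x j \<oplus>\<^bsub>M j\<^esub> y j),
     smult = (\<lambda>a x. \<lambda>j\<in>J. a \<odot>\<^bsub>M j\<^esub> x j)\<rparr>"

text \<open>The quotient of the subsemimodule \<open>Z\<close> of \<open>M\<close> by a congruence \<open>\<rho>\<close> on \<open>Z\<close>. The unions over
  representatives are single \<open>\<rho>\<close>-classes because \<open>\<rho>\<close> respects the operations.\<close>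

definition semimodule_quotient ::
    "('r, 'm) module \<Rightarrow> 'm set \<Rightarrow> ('m \<times> 'm) set \<Rightarrow> ('r, 'm set) module" where
  "semimodule_quotient M Z \<rho> =
    \<lparr>carrier = Z // \<rho>, mult = undefined, one = undefined,
     zero = \<rho> `` {\<zero>\<^bsub>M\<^esub>}, add = (\<lambda>A B. \<Union>x\<in>A. \<Union>y\<in>B. \<rho> `` {x \<oplus>\<^bsub>M\<^esub> y}),
     smult = (\<lambda>a A. \<Union>x\<in>A. \<rho> `` {a \<odot>\<^bsub>M\<^esub> x})\<rparr>"


section \<open>Sheaves of semimodules\<close>

text \<open>\<open>res U V\<close> is the restriction map \<open>\<F>(U) \<rightarrow> \<F>(V)\<close> for open \<open>V \<subseteq> U\<close>. Values of \<open>F\<close> and \<open>res\<close>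
  outside the open sets are irrelevant.\<close>

locale presheaf_of_semimodules =
  fixes R :: "('r, 'x) ring_scheme" and X :: "'a topology"
    and F :: "'a set \<Rightarrow> ('r, 'm) module" and res :: "'a set \<Rightarrow> 'a set \<Rightarrow> 'm \<Rightarrow> 'm"
  assumes semiring: "commutative_semiring R"
    and sections_semimodule: "openin X U \<Longrightarrow> semimodule R (F U)"
    and res_hom: "\<lbrakk>openin X U; openin X V; V \<subseteq> U\<rbrakk> \<Longrightarrow> semimodule_hom R (F U) (F V) (res U V)"
    and res_id: "\<lbrakk>openin X U; s \<in> carrier (F U)\<rbrakk> \<Longrightarrow> res U U s = s"
    and res_comp: "\<lbrakk>openin X U; openin X V; openin X W; W \<subseteq> V; V \<subseteq> U; s \<in> carrier (F U)\<rbrakk>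
      \<Longrightarrow> res V W (res U V s) = res U W s"

text \<open>A covering is taken to be a set of open sets; this loses nothing against indexed families,
  since compatible sections over equal members of a family are equal because \<open>res U U\<close> is the identity. The empty covering
  of the empty set is included, so \<open>\<F>(\<emptyset>) = 0\<close>.\<close>

locale sheaf_of_semimodules = presheaf_of_semimodules +
  assumes sheaf: "\<lbrakk>\<And>V. V \<in> \<V> \<Longrightarrow> openin X V;
      \<And>V. V \<in> \<V> \<Longrightarrow> s V \<in> carrier (F V);
      \<And>V W. \<lbrakk>V \<in> \<V>; W \<in> \<V>\<rbrakk> \<Longrightarrow> res V (V \<inter> W) (s V) = res W (V \<inter> W) (s W)\<rbrakk>
    \<Longrightarrow> \<exists>!t. t \<in> carrier (F (\<Union>\<V>)) \<and> (\<forall>V\<in>\<V>. res (\<Union>\<V>) V t = s V)"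


section \<open>Cech cohomology\<close>

definition open_covering :: "'a topology \<Rightarrow> 'i set \<Rightarrow> ('i \<Rightarrow> 'a set) \<Rightarrow> bool" where
  "open_covering X I \<U> \<longleftrightarrow> (\<forall>i\<in>I. openin X (\<U> i)) \<and> (\<Union>i\<in>I. \<U> i) = topspace X"

text \<open>The index tuples \<open>i\<^sub>0 < \<dots> < i\<^sub>n\<close>, as lists. For \<open>n < 0\<close> there are none (in particular not the
  empty list for \<open>n = -1\<close>), so that the product defining the cochains is the zero semimodule.\<close>

definition cech_indices :: "'i::linorder set \<Rightarrow> int \<Rightarrow> 'i list set" where
  "cech_indices I n =
    {is. 0 \<le> n \<and> int (length is) = n + 1 \<and> set is \<subseteq> I \<and> sorted_wrt (<) is}"

definition cech_inter :: "('i \<Rightarrow> 'a set) \<Rightarrow> 'i list \<Rightarrow> 'a set" where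
  "cech_inter \<U> is = (\<Inter>i\<in>set is. \<U> i)"

definition remove_nth :: "nat \<Rightarrow> 'i list \<Rightarrow> 'i list" where
  "remove_nth k is = take k is @ drop (Suc k) is"

definition cech_cochains ::
    "('a set \<Rightarrow> ('r, 'm) module) \<Rightarrow> 'i::linorder set \<Rightarrow> ('i \<Rightarrow> 'a set) \<Rightarrow> int
      \<Rightarrow> ('r, 'i list \<Rightarrow> 'm) module" where
  "cech_cochains F I \<U> n = semimodule_product (cech_indices I n) (\<lambda>is. F (cech_inter \<U> is))"

text \<open>The sum of the faces with position \<open>k\<close> satisfying \<open>P\<close>, for \<open>P\<close> either \<open>even\<close> or \<open>odd\<close>; it is
  the zero map in negative degrees. An index tuple of degree \<open>n + 1\<close> has length \<open>n + 2\<close>.\<close>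

definition cech_d ::
    "(nat \<Rightarrow> bool) \<Rightarrow> ('a set \<Rightarrow> ('r, 'm) module) \<Rightarrow> ('a set \<Rightarrow> 'a set \<Rightarrow> 'm \<Rightarrow> 'm)
      \<Rightarrow> 'i::linorder set \<Rightarrow> ('i \<Rightarrow> 'a set) \<Rightarrow> int \<Rightarrow> ('i list \<Rightarrow> 'm) \<Rightarrow> ('i list \<Rightarrow> 'm)" where
  "cech_d P F res I \<U> n x =
    (if n < 0 then \<zero>\<^bsub>cech_cochains F I \<U> (n + 1)\<^esub>
     else (\<lambda>is\<in>cech_indices I (n + 1).
       \<Oplus>\<^bsub>F (cech_inter \<U> is)\<^esub> k\<in>{k. k < length is \<and> P k}.
         res (cech_inter \<U> (remove_nth k is)) (cech_inter \<U> is) (x (remove_nth k is))))"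

abbreviation "cech_d_plus \<equiv> cech_d even"
abbreviation "cech_d_minus \<equiv> cech_d odd"

definition cech_cocycles ::
    "('a set \<Rightarrow> ('r, 'm) module) \<Rightarrow> ('a set \<Rightarrow> 'a set \<Rightarrow> 'm \<Rightarrow> 'm)
      \<Rightarrow> 'i::linorder set \<Rightarrow> ('i \<Rightarrow> 'a set) \<Rightarrow> int \<Rightarrow> ('i list \<Rightarrow> 'm) set" where
  "cech_cocycles F res I \<U> n =
    {x \<in> carrier (cech_cochains F I \<U> n). cech_d_plus F res I \<U> n x = cech_d_minus F res I \<U> n x}"

definition cech_rho ::
    "('a set \<Rightarrow> ('r, 'm) module) \<Rightarrow> ('a set \<Rightarrow> 'a set \<Rightarrow> 'm \<Rightarrow> 'm)
      \<Rightarrow> 'i::linorder set \<Rightarrow> ('i \<Rightarrow> 'a set) \<Rightarrow> int \<Rightarrow> (('i list \<Rightarrow> 'm) \<times> ('i list \<Rightarrow> 'm)) set" where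
  "cech_rho F res I \<U> n =
    {(x, y). x \<in> cech_cocycles F res I \<U> n \<and> y \<in> cech_cocycles F res I \<U> n \<and>
      (\<exists>u\<in>carrier (cech_cochains F I \<U> (n - 1)). \<exists>v\<in>carrier (cech_cochains F I \<U> (n - 1)).
        x \<oplus>\<^bsub>cech_cochains F I \<U> n\<^esub> cech_d_plus F res I \<U> (n - 1) u
          \<oplus>\<^bsub>cech_cochains F I \<U> n\<^esub> cech_d_minus F res I \<U> (n - 1) v
        = y \<oplus>\<^bsub>cech_cochains F I \<U> n\<^esub> cech_d_plus F res I \<U> (n - 1) v
          \<oplus>\<^bsub>cech_cochains F I \<U> n\<^esub> cech_d_minus F res I \<U> (n - 1) u)}"

definition cech_cohomology ::
    "('a set \<Rightarrow> ('r, 'm) module) \<Rightarrow> ('a set \<Rightarrow> 'a set \<Rightarrow> 'm \<Rightarrow> 'm)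
      \<Rightarrow> 'i::linorder set \<Rightarrow> ('i \<Rightarrow> 'a set) \<Rightarrow> int \<Rightarrow> ('r, ('i list \<Rightarrow> 'm) set) module" where
  "cech_cohomology F res I \<U> n =
    semimodule_quotient (cech_cochains F I \<U> n) (cech_cocycles F res I \<U> n) (cech_rho F res I \<U> n)"

text \<open>The map \<open>\<F>(X) \<rightarrow> H\<^sup>0(\<U>, \<F>)\<close> sending \<open>s\<close> to the class of the family of its restrictions to the
  members of the covering.\<close>

definition cech_restriction_map ::
    "'a topology \<Rightarrow> ('a set \<Rightarrow> ('r, 'm) module) \<Rightarrow> ('a set \<Rightarrow> 'a set \<Rightarrow> 'm \<Rightarrow> 'm)
      \<Rightarrow> 'i::linorder set \<Rightarrow> ('i \<Rightarrow> 'a set) \<Rightarrow> 'm \<Rightarrow> ('i list \<Rightarrow> 'm) set" where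
  "cech_restriction_map X F res I \<U> s =
    cech_rho F res I \<U> 0 `` {\<lambda>is\<in>cech_indices I 0. res (topspace X) (cech_inter \<U> is) s}"

end

theory Submission
  imports Defs
begin

text \<open>
  There are no cochains in degree \<open>-1\<close> apart from zero, so \<open>\<rho>\<^sup>0\<close> is equality, and a cochain of
  degree \<open>0\<close> is a cocycle iff its components agree on the overlaps \<open>U\<^sub>i \<inter> U\<^sub>j\<close> with \<open>i < j\<close>. By
  symmetry they then agree on all overlaps, so the sheaf axiom says that restriction is a bijection
  from \<open>\<F>(X)\<close> onto the cocycles. It respects the operations, hence the semimodule laws of
  \<open>H\<^sup>0\<close> are transported from \<open>\<F>(X)\<close>.
\<close>

section \<open>Transport of semimodule structure\<close>

text \<open>That \<open>N\<close> is a semimodule is a conclusion here: \<open>f\<close> is onto and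
  preserves the operations, so each law in \<open>N\<close> is the image of the same law in
  \<open>M\<close>. This spares a direct check of the laws for the quotient.\<close>

lemma semimodule_isoI:
  assumes "semimodule R M"
    and bij: "bij_betw f (carrier M) (carrier N)"
    and zero: "f \<zero>\<^bsub>M\<^esub> = \<zero>\<^bsub>N\<^esub>"
    and add: "\<And>x y. \<lbrakk>x \<in> carrier M; y \<in> carrier M\<rbrakk> \<Longrightarrow> f (x \<oplus>\<^bsub>M\<^esub> y) = f x \<oplus>\<^bsub>N\<^esub> f y"
    and smult: "\<And>a x. \<lbrakk>a \<in> carrier R; x \<in> carrier M\<rbrakk> \<Longrightarrow> f (a \<odot>\<^bsub>M\<^esub> x) = a \<odot>\<^bsub>N\<^esub> f x"
  shows "semimodule_iso R M N f"
proof -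
  interpret M: semimodule R M by fact
  have carrier_N: "carrier N = f ` carrier M"
    using bij by (simp add: bij_betw_def)
  \<comment> \<open>Read from right to left, \<open>add\<close> and \<open>zero\<close> pull the
    operations of \<open>N\<close> inside \<open>f\<close>, where the laws of \<open>M\<close>
    apply.\<close>
  have "abelian_monoid N"
    by (rule abelian_monoidI)
      (auto simp: carrier_N add[symmetric] zero[symmetric] M.M.a_ac)
  then have "semimodule R N"
    unfolding semimodule_def semimodule_axioms_def
    by (auto simp: carrier_N add[symmetric] zero[symmetric] smult[symmetric]
        M.commutative_semiring_axioms M.smult_closed M.smult_add_left M.smult_add_right
        M.smult_mult M.smult_one M.smult_zero_left M.smult_zero_right)
  then show ?thesis
    using assms(1) bij zero add smult
    by (auto simp: semimodule_iso_def semimodule_iso_axioms_def semimodule_hom_def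
        semimodule_hom_axioms_def carrier_N)
qed

section \<open>Index tuples and cochains\<close>

lemma cech_indices_0: "cech_indices I 0 = (\<lambda>i. [i]) ` I"
  by (auto simp: cech_indices_def length_Suc_conv)

lemma cech_indices_1: "cech_indices I 1 = {[i, j] | i j. i \<in> I \<and> j \<in> I \<and> i < j}"
  by (auto simp: cech_indices_def length_Suc_conv numeral_2_eq_2)

lemma cech_indices_neg: "n < 0 \<Longrightarrow> cech_indices I n = {}"
  by (simp add: cech_indices_def)

lemma cech_inter_singleton [simp]: "cech_inter \<U> [i] = \<U> i"
  and cech_inter_pair [simp]: "cech_inter \<U> [i, j] = \<U> i \<inter> \<U> j"
  by (simp_all add: cech_inter_def)

lemma carrier_cech_cochains:
  "carrier (cech_cochains F I \<U> n) = (\<Pi>\<^sub>E is\<in>cech_indices I n. carrier (F (cech_inter \<U> is)))"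
  by (simp add: cech_cochains_def semimodule_product_def)

lemma zero_cech_cochains:
  "\<zero>\<^bsub>cech_cochains F I \<U> n\<^esub> = (\<lambda>is\<in>cech_indices I n. \<zero>\<^bsub>F (cech_inter \<U> is)\<^esub>)"
  by (simp add: cech_cochains_def semimodule_product_def)

lemma add_cech_cochains:
  "x \<oplus>\<^bsub>cech_cochains F I \<U> n\<^esub> y = (\<lambda>is\<in>cech_indices I n. x is \<oplus>\<^bsub>F (cech_inter \<U> is)\<^esub> y is)"
  by (simp add: cech_cochains_def semimodule_product_def)

lemma smult_cech_cochains:
  "a \<odot>\<^bsub>cech_cochains F I \<U> n\<^esub> x = (\<lambda>is\<in>cech_indices I n. a \<odot>\<^bsub>F (cech_inter \<U> is)\<^esub> x is)"
  by (simp add: cech_cochains_def semimodule_product_def)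

section \<open>Cocycles and the congruence in degree 0\<close>

locale presheaf_with_open_covering = presheaf_of_semimodules R X F res
  for R :: "('r, 'x) ring_scheme" and X :: "'a topology"
    and F :: "'a set \<Rightarrow> ('r, 'm) module" and res :: "'a set \<Rightarrow> 'a set \<Rightarrow> 'm \<Rightarrow> 'm" +
  fixes I :: "'i::linorder set" and \<U> :: "'i \<Rightarrow> 'a set"
  assumes open_covering: "open_covering X I \<U>"
begin

lemma openin_cover [simp]: "i \<in> I \<Longrightarrow> openin X (\<U> i)"
  and Union_cover: "\<Union>(\<U> ` I) = topspace X"
  using open_covering by (simp_all add: open_covering_def)

lemma cover_subset: "i \<in> I \<Longrightarrow> \<U> i \<subseteq> topspace X"
  by (simp add: openin_subset)

lemma res_closed:
  "\<lbrakk>openin X U; openin X V; V \<subseteq> U; s \<in> carrier (F U)\<rbrakk> \<Longrightarrow> res U V s \<in> carrier (F V)"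
  by (rule semimodule_hom.hom_closed[OF res_hom])

lemma finsum_singleton:
  "\<lbrakk>openin X U; s k \<in> carrier (F U)\<rbrakk> \<Longrightarrow> (\<Oplus>\<^bsub>F U\<^esub> j\<in>{k::nat}. s j) = s k"
proof -
  assume U: "openin X U" and s: "s k \<in> carrier (F U)"
  interpret FU: semimodule R "F U" by (rule sections_semimodule[OF U])
  show ?thesis using s by simp
qed

text \<open>A pair has just two faces: deleting position 0 leaves \<open>[j]\<close> and deleting
  position 1 leaves \<open>[i]\<close>, so each differential is a one-term sum.\<close>

lemma cech_d_0:
  assumes "x \<in> carrier (cech_cochains F I \<U> 0)" "i \<in> I" "j \<in> I" "i < j"
  shows "cech_d_plus F res I \<U> 0 x [i, j] = res (\<U> j) (\<U> i \<inter> \<U> j) (x [j])"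
    and "cech_d_minus F res I \<U> 0 x [i, j] = res (\<U> i) (\<U> i \<inter> \<U> j) (x [i])"
proof -
  have even: "{k. k < Suc (Suc 0) \<and> even k} = {0}"
    and odd: "{k. k < Suc (Suc 0) \<and> odd k} = {Suc 0}"
    by (auto simp: less_Suc_eq)
  have "x [i] \<in> carrier (F (\<U> i))" "x [j] \<in> carrier (F (\<U> j))"
    using assms by (auto simp: carrier_cech_cochains cech_indices_0 dest: PiE_mem)
  with assms have "res (\<U> j) (\<U> i \<inter> \<U> j) (x [j]) \<in> carrier (F (\<U> i \<inter> \<U> j))"
    "res (\<U> i) (\<U> i \<inter> \<U> j) (x [i]) \<in> carrier (F (\<U> i \<inter> \<U> j))"
    by (auto intro!: res_closed)
  with assms
  show "cech_d_plus F res I \<U> 0 x [i, j] = res (\<U> j) (\<U> i \<inter> \<U> j) (x [j])"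
    and "cech_d_minus F res I \<U> 0 x [i, j] = res (\<U> i) (\<U> i \<inter> \<U> j) (x [i])"
    by (simp_all add: cech_d_def cech_indices_1 even odd finsum_singleton remove_nth_def openin_Int)
qed

text \<open>Stated over all pairs so that it matches the compatibility hypothesis of
  \<open>sheaf\<close>.\<close>

lemma mem_cech_cocycles_0_iff:
  "x \<in> cech_cocycles F res I \<U> 0 \<longleftrightarrow>
    x \<in> (\<Pi>\<^sub>E is\<in>cech_indices I 0. carrier (F (cech_inter \<U> is))) \<and>
    (\<forall>i\<in>I. \<forall>j\<in>I. res (\<U> i) (\<U> i \<inter> \<U> j) (x [i]) = res (\<U> j) (\<U> i \<inter> \<U> j) (x [j]))"
  (is "_ \<longleftrightarrow> ?C \<and> ?compatible")
proof (cases ?C)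
  case True
  then have x: "x \<in> carrier (cech_cochains F I \<U> 0)"
    by (simp add: carrier_cech_cochains)
  \<comment> \<open>Both differentials are extensional, so their equality can be tested on the pairs
    in \<open>cech_indices I 1\<close>.\<close>
  have ext: "cech_d P F res I \<U> 0 x \<in> extensional (cech_indices I 1)" for P
    by (simp add: cech_d_def)
  have "x \<in> cech_cocycles F res I \<U> 0 \<longleftrightarrow>
      (\<forall>is\<in>cech_indices I 1. cech_d_plus F res I \<U> 0 x is = cech_d_minus F res I \<U> 0 x is)"
    using x ext by (auto simp: cech_cocycles_def intro: extensionalityI)
  also have "\<dots> \<longleftrightarrow> (\<forall>i\<in>I. \<forall>j\<in>I. i < j \<longrightarrow>
      res (\<U> j) (\<U> i \<inter> \<U> j) (x [j]) = res (\<U> i) (\<U> i \<inter> \<U> j) (x [i]))"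
    using x by (force simp: cech_indices_1 cech_d_0)
  \<comment> \<open>The order is total: the diagonal case is reflexivity, and \<open>j < i\<close>
    is the given case with the two sides exchanged.\<close>
  also have "\<dots> \<longleftrightarrow> ?compatible"
    by (metis Int_commute linorder_neqE)
  finally show ?thesis
    using True by blast
next
  case False
  then show ?thesis
    by (simp add: cech_cocycles_def carrier_cech_cochains)
qed

lemma add_zero_cech_cochains:
  assumes "x \<in> carrier (cech_cochains F I \<U> 0)"
  shows "x \<oplus>\<^bsub>cech_cochains F I \<U> 0\<^esub> \<zero>\<^bsub>cech_cochains F I \<U> 0\<^esub> = x"
proof (rule extensionalityI[where A = "cech_indices I 0"])
  fix "is" assume "is": "is \<in> cech_indices I 0"
  then interpret semimodule R "F (cech_inter \<U> is)"
    by (intro sections_semimodule) (auto simp: cech_indices_0)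
  have "x is \<in> carrier (F (cech_inter \<U> is))"
    using assms "is" by (auto simp: carrier_cech_cochains dest: PiE_mem)
  then show "(x \<oplus>\<^bsub>cech_cochains F I \<U> 0\<^esub> \<zero>\<^bsub>cech_cochains F I \<U> 0\<^esub>) is = x is"
    using "is" by (simp add: add_cech_cochains zero_cech_cochains)
qed (use assms in \<open>auto simp: add_cech_cochains carrier_cech_cochains PiE_def\<close>)

lemma cech_rho_0: "cech_rho F res I \<U> 0 = Id_on (cech_cocycles F res I \<U> 0)"
proof -
  \<comment> \<open>A product over the empty index set has one element, which supplies both
    \<open>u\<close> and \<open>v\<close>.\<close>
  have "carrier (cech_cochains F I \<U> (- 1)) \<noteq> {}"
    by (simp add: carrier_cech_cochains cech_indices_neg)
  \<comment> \<open>This is the separate clause for negative degrees in \<open>cech_d\<close>; the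
    face formula would instead evaluate \<open>u\<close> at the empty list.\<close>
  moreover have "cech_d P F res I \<U> (- 1) u = \<zero>\<^bsub>cech_cochains F I \<U> 0\<^esub>" for P u
    by (simp add: cech_d_def)
  moreover have "x \<oplus>\<^bsub>cech_cochains F I \<U> 0\<^esub> \<zero>\<^bsub>cech_cochains F I \<U> 0\<^esub> = x"
    if "x \<in> cech_cocycles F res I \<U> 0" for x
    using that by (simp add: cech_cocycles_def add_zero_cech_cochains)
  ultimately show ?thesis
    by (auto simp: cech_rho_def Id_on_def)
qed

section \<open>Restriction of global sections to the covering\<close>

text \<open>The representative whose class is \<open>cech_restriction_map\<close>; bijectivity and
  compatibility with the operations are checked on it, before passing to classes.\<close>

definition restrict_to_cover :: "'m \<Rightarrow> 'i list \<Rightarrow> 'm" where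
  "restrict_to_cover s = (\<lambda>is\<in>cech_indices I 0. res (topspace X) (cech_inter \<U> is) s)"

lemma restrict_to_cover_singleton [simp]:
  "i \<in> I \<Longrightarrow> restrict_to_cover s [i] = res (topspace X) (\<U> i) s"
  by (simp add: restrict_to_cover_def cech_indices_0)

lemma res_hom_cover: "i \<in> I \<Longrightarrow> semimodule_hom R (F (topspace X)) (F (\<U> i)) (res (topspace X) (\<U> i))"
  by (simp add: res_hom cover_subset)

text \<open>By functoriality both restrictions to an overlap equal the direct restriction from
  \<open>topspace X\<close>.\<close>

lemma restrict_to_cover_cocycle:
  assumes "s \<in> carrier (F (topspace X))"
  shows "restrict_to_cover s \<in> cech_cocycles F res I \<U> 0"
  unfolding mem_cech_cocycles_0_iff
proof (intro conjI ballI)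
  show "restrict_to_cover s \<in> (\<Pi>\<^sub>E is\<in>cech_indices I 0. carrier (F (cech_inter \<U> is)))"
    using assms by (auto simp: restrict_to_cover_def cech_indices_0 intro!: res_closed dest: cover_subset[THEN subsetD])
next
  fix i j assume "i \<in> I" "j \<in> I"
  then show "res (\<U> i) (\<U> i \<inter> \<U> j) (restrict_to_cover s [i]) =
      res (\<U> j) (\<U> i \<inter> \<U> j) (restrict_to_cover s [j])"
    using assms by (simp add: res_comp cover_subset openin_Int)
qed

lemma restrict_to_cover_zero:
  "restrict_to_cover \<zero>\<^bsub>F (topspace X)\<^esub> = \<zero>\<^bsub>cech_cochains F I \<U> 0\<^esub>"
  unfolding restrict_to_cover_def zero_cech_cochains
  by (rule restrict_ext) (auto simp: cech_indices_0 semimodule_hom.hom_zero[OF res_hom_cover])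

lemma restrict_to_cover_add:
  assumes "s \<in> carrier (F (topspace X))" "t \<in> carrier (F (topspace X))"
  shows "restrict_to_cover (s \<oplus>\<^bsub>F (topspace X)\<^esub> t) =
    restrict_to_cover s \<oplus>\<^bsub>cech_cochains F I \<U> 0\<^esub> restrict_to_cover t"
  unfolding restrict_to_cover_def add_cech_cochains
  by (rule restrict_ext) (use assms in \<open>auto simp: cech_indices_0 semimodule_hom.hom_add[OF res_hom_cover]\<close>)

lemma restrict_to_cover_smult:
  assumes "a \<in> carrier R" "s \<in> carrier (F (topspace X))"
  shows "restrict_to_cover (a \<odot>\<^bsub>F (topspace X)\<^esub> s) =
    a \<odot>\<^bsub>cech_cochains F I \<U> 0\<^esub> restrict_to_cover s"
  unfolding restrict_to_cover_def smult_cech_cochains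
  by (rule restrict_ext) (use assms in \<open>auto simp: cech_indices_0 semimodule_hom.hom_smult[OF res_hom_cover]\<close>)

lemma cech_restriction_map_eq:
  "s \<in> carrier (F (topspace X)) \<Longrightarrow> cech_restriction_map X F res I \<U> s = {restrict_to_cover s}"
  using restrict_to_cover_cocycle[of s]
  by (auto simp: cech_restriction_map_def restrict_to_cover_def cech_rho_0)

text \<open>Since \<rho> is equality on cocycles, passing to classes is the bijection from
  \<open>x\<close> to \<open>{x}\<close>. Only bijectivity onto the cocycles is left to the sheaf
  axiom.\<close>

lemma semimodule_iso_cech_restriction_map:
  assumes bij: "bij_betw restrict_to_cover (carrier (F (topspace X))) (cech_cocycles F res I \<U> 0)"
  shows "semimodule_iso R (F (topspace X)) (cech_cohomology F res I \<U> 0)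
    (cech_restriction_map X F res I \<U>)"
proof (rule semimodule_isoI)
  let ?H = "cech_cohomology F res I \<U> 0" and ?r = "cech_restriction_map X F res I \<U>"
  interpret M: semimodule R "F (topspace X)"
    by (rule sections_semimodule) simp
  show "semimodule R (F (topspace X))" ..
  have "carrier ?H = (\<lambda>x. {x}) ` cech_cocycles F res I \<U> 0"
    by (auto simp: cech_cohomology_def semimodule_quotient_def cech_rho_0 quotient_def)
  moreover have "bij_betw (\<lambda>x. {x}) (cech_cocycles F res I \<U> 0) ((\<lambda>x. {x}) ` cech_cocycles F res I \<U> 0)"
    by (simp add: bij_betw_def)
  ultimately have "bij_betw (\<lambda>s. {restrict_to_cover s}) (carrier (F (topspace X))) (carrier ?H)"
    using bij_betw_trans[OF bij] by (fastforce simp: comp_def)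
  then show "bij_betw ?r (carrier (F (topspace X))) (carrier ?H)"
    by (simp add: cech_restriction_map_eq cong: bij_betw_cong)
  show "?r \<zero>\<^bsub>F (topspace X)\<^esub> = \<zero>\<^bsub>?H\<^esub>"
    by (simp add: cech_restriction_map_eq cech_cohomology_def semimodule_quotient_def cech_rho_0
        restrict_to_cover_zero[symmetric] restrict_to_cover_cocycle)
  \<comment> \<open>On singleton classes the unions in the quotient operations have one term. The
    sum is again the restriction of a section, hence a cocycle, so its class is a singleton
    too.\<close>
  show "?r (s \<oplus>\<^bsub>F (topspace X)\<^esub> t) = ?r s \<oplus>\<^bsub>?H\<^esub> ?r t"
    if "s \<in> carrier (F (topspace X))" "t \<in> carrier (F (topspace X))" for s t
    using that
    by (simp add: cech_restriction_map_eq cech_cohomology_def semimodule_quotient_def cech_rho_0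
        restrict_to_cover_add[symmetric] restrict_to_cover_cocycle)
  show "?r (a \<odot>\<^bsub>F (topspace X)\<^esub> s) = a \<odot>\<^bsub>?H\<^esub> ?r s"
    if "a \<in> carrier R" "s \<in> carrier (F (topspace X))" for a s
    using that
    by (simp add: cech_restriction_map_eq cech_cohomology_def semimodule_quotient_def cech_rho_0
        restrict_to_cover_smult[symmetric] restrict_to_cover_cocycle M.smult_closed)
qed

end

section \<open>Gluing\<close>

locale sheaf_with_open_covering =
  sheaf_of_semimodules R X F res + presheaf_with_open_covering R X F res I \<U>
  for R :: "('r, 'x) ring_scheme" and X :: "'a topology"
    and F :: "'a set \<Rightarrow> ('r, 'm) module" and res :: "'a set \<Rightarrow> 'a set \<Rightarrow> 'm \<Rightarrow> 'm"
    and I :: "'i::linorder set" and \<U> :: "'i \<Rightarrow> 'a set"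
begin

text \<open>The axiom \<open>sheaf\<close> speaks of a set of open sets, so the indexed family
  \<open>x\<close> must first descend to the image of \<open>\<U>\<close>.\<close>

lemma ex1_glue:
  assumes x: "x \<in> cech_cocycles F res I \<U> 0"
  shows "\<exists>!t. t \<in> carrier (F (topspace X)) \<and> (\<forall>i\<in>I. res (topspace X) (\<U> i) t = x [i])"
proof -
  have x_closed: "x [i] \<in> carrier (F (\<U> i))" if "i \<in> I" for i
    using x that by (auto simp: mem_cech_cocycles_0_iff cech_indices_0 dest: PiE_mem)
  have compatible: "res (\<U> i) (\<U> i \<inter> \<U> j) (x [i]) = res (\<U> j) (\<U> i \<inter> \<U> j) (x [j])"
    if "i \<in> I" "j \<in> I" for i j
    using x that by (auto simp: mem_cech_cocycles_0_iff)
  \<comment> \<open>If two members coincide, their overlap is the whole member, and compatibility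
    together with \<open>res_id\<close> identifies the sections.\<close>
  have same: "x [i] = x [j]" if "i \<in> I" "j \<in> I" "\<U> i = \<U> j" for i j
    using compatible[OF that(1,2)] that x_closed[of i] x_closed[of j] by (simp add: res_id)
  \<comment> \<open>An arbitrary index is chosen for each \<open>V\<close>; by \<open>same\<close>
    the section does not depend on it.\<close>
  define s where "s V = x [inv_into I \<U> V]" for V
  have s: "s (\<U> i) = x [i]" if "i \<in> I" for i
    using that by (auto simp: s_def f_inv_into_f inv_into_into intro: same)
  have "\<exists>!t. t \<in> carrier (F (\<Union>(\<U> ` I))) \<and> (\<forall>V\<in>\<U> ` I. res (\<Union>(\<U> ` I)) V t = s V)"
    by (rule sheaf) (auto simp: s x_closed intro: compatible)
  then show ?thesis
    by (simp add: Union_cover s)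
qed

lemma bij_betw_restrict_to_cover:
  "bij_betw restrict_to_cover (carrier (F (topspace X))) (cech_cocycles F res I \<U> 0)"
proof -
  have "\<exists>!s. s \<in> carrier (F (topspace X)) \<and> restrict_to_cover s = x"
    if x: "x \<in> cech_cocycles F res I \<U> 0" for x
  proof -
    have "restrict_to_cover s \<in> extensional (cech_indices I 0)" "x \<in> extensional (cech_indices I 0)" for s
      using x by (simp_all add: restrict_to_cover_def mem_cech_cocycles_0_iff PiE_def)
    then have "restrict_to_cover s = x \<longleftrightarrow> (\<forall>is\<in>cech_indices I 0. restrict_to_cover s is = x is)" for s
      by (auto intro: extensionalityI)
    then have "restrict_to_cover s = x \<longleftrightarrow> (\<forall>i\<in>I. res (topspace X) (\<U> i) s = x [i])" for s
      by (simp add: cech_indices_0)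
    with ex1_glue[OF x] show ?thesis
      by simp
  qed
  \<comment> \<open>Existence gives surjectivity; uniqueness, applied to the cocycle of a given
    section, gives injectivity.\<close>
  then show ?thesis
    using restrict_to_cover_cocycle by (intro bij_betwI') blast+
qed

end

theorem proposition4p5:
  fixes R :: "('r, 'x) ring_scheme" and X :: "'a topology"
    and F :: "'a set \<Rightarrow> ('r, 'm) module" and res :: "'a set \<Rightarrow> 'a set \<Rightarrow> 'm \<Rightarrow> 'm"
    and I :: "'i::linorder set" and \<U> :: "'i \<Rightarrow> 'a set"
  assumes "commutative_semiring R"
    and "sheaf_of_semimodules R X F res"
    and "open_covering X I \<U>"
  shows "semimodule_iso R (F (topspace X)) (cech_cohomology F res I \<U> 0)
    (cech_restriction_map X F res I \<U>)"
proof -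
  interpret sheaf_of_semimodules R X F res by fact
  interpret sheaf_with_open_covering R X F res I \<U>
    by unfold_locales fact
  show ?thesis
    by (rule semimodule_iso_cech_restriction_map[OF bij_betw_restrict_to_cover])
qed

end
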